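(* Let $(\mathcal{S}^{(0)},\mathcal{S},\mathfrak{s},\mathfrak{r})$ be a graph with $\mathcal{S}^{(0)}=\mathfrak{s}(\mathcal{S})\cup\mathfrak{r}(\mathcal{S})$, and let $\mu\colon\mathcal{S}^{(2)}\to\mathcal{S}$, $\mu(a,b)=ab$, be a function. Consider the assertions: (1) $(\mathcal{S}^{(0)},\mathcal{S},\mathfrak{s},\mathfrak{r},\mu)$ is a graphed semigroupoid; (2) $(\mathcal{S},\mathcal{S}^{(2)},\mu)$ is an Exel semigroupoid; (3) for all $(a,b)\in\mathcal{S}^{(2)}$, $\mathfrak{s}(ab)=\mathfrak{s}(b)$ and $\mathfrak{r}(ab)=\mathfrak{r}(a)$. Then (1) is equivalent to the conjunction of (2) and (3). If $\mathcal{S}$ has no sources nor sinks, then (2) implies (3) (and thus (1) is equivalent to (2) in this case).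
   Context: A graph consists of a vertex set $G^{(0)}$, an arrow set $G$ and maps $\mathfrak{s},\mathfrak{r}\colon G\to G^{(0)}$ (source and range). $G^{(2)}=\{(a,b):\mathfrak{s}(a)=\mathfrak{r}(b)\}$ and $G^{(3)}=\{(a,b,c):\mathfrak{s}(a)=\mathfrak{r}(b),\mathfrak{s}(b)=\mathfrak{r}(c)\}$. A sink is a vertex $v$ with $\mathfrak{s}^{-1}(v)=\varnothing$; a source is a vertex $v$ with $\mathfrak{r}^{-1}(v)=\varnothing$. A graphed semigroupoid is a tuple $(\mathcal{S}^{(0)},\mathcal{S},\mathfrak{s},\mathfrak{r},\mu)$ where $(\mathcal{S}^{(0)},\mathcal{S},\mathfrak{s},\mathfrak{r})$ is a graph with $\mathcal{S}^{(0)}=\mathfrak{s}(\mathcal{S})\cup\mathfrak{r}(\mathcal{S})$ and $\mu\colon\mathcal{S}^{(2)}\to\mathcal{S}$, $\mu(a,b)=ab$, satisfies $\mathfrak{s}(ab)=\mathfrak{s}(b)$ and $\mathfrak{r}(ab)=\mathfrak{r}(a)$ for all $(a,b)\in\mathcal{S}^{(2)}$, and $(ab)c=a(bc)$ for all $(a,b,c)\in\mathcal{S}^{(3)}$. An Exel semigroupoid is a triple $(\Lambda,\Lambda^{[2]},\mu)$ with $\Lambda$ a set, $\Lambda^{[2]}\subseteq\Lambda\times\Lambda$ and $\mu\colon\Lambda^{[2]}\to\Lambda$, $\mu(f,g)=fg$, such that for all $f,g,h\in\Lambda$ the statements (i) $(f,g)\in\Lambda^{[2]}$ and $(g,h)\in\Lambda^{[2]}$;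 (ii) $(f,g)\in\Lambda^{[2]}$ and $(fg,h)\in\Lambda^{[2]}$; (iii) $(g,h)\in\Lambda^{[2]}$ and $(f,gh)\in\Lambda^{[2]}$ are equivalent, and if they hold then $(fg)h=f(gh)$. *)

theory Defs
  imports "HOL-Library.FuncSet"
begin

text \<open>Arrow and vertex sets are carriers inside types, and source, range and product are total
  HOL functions. The definitions use their values only on the arrow set and on the set of
  composable pairs, respectively.\<close>

definition graph :: "'v set \<Rightarrow> 'a set \<Rightarrow> ('a \<Rightarrow> 'v) \<Rightarrow> ('a \<Rightarrow> 'v) \<Rightarrow> bool" where
  "graph V G s r \<longleftrightarrow> s \<in> G \<rightarrow> V \<and> r \<in> G \<rightarrow> V"

definition composable_pairs :: "'a set \<Rightarrow> ('a \<Rightarrow> 'v) \<Rightarrow> ('a \<Rightarrow> 'v) \<Rightarrow> ('a \<times> 'a) set" where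
  "composable_pairs G s r = {(a, b). a \<in> G \<and> b \<in> G \<and> s a = r b}"

definition composable_triples ::
    "'a set \<Rightarrow> ('a \<Rightarrow> 'v) \<Rightarrow> ('a \<Rightarrow> 'v) \<Rightarrow> ('a \<times> 'a \<times> 'a) set" where
  "composable_triples G s r =
     {(a, b, c). a \<in> G \<and> b \<in> G \<and> c \<in> G \<and> s a = r b \<and> s b = r c}"

definition is_sink :: "'v set \<Rightarrow> 'a set \<Rightarrow> ('a \<Rightarrow> 'v) \<Rightarrow> 'v \<Rightarrow> bool" where
  "is_sink V G s v \<longleftrightarrow> v \<in> V \<and> s -` {v} \<inter> G = {}"

text \<open>A source is a vertex that is the range of no arrow, so the function argument below is
  the range map.\<close>

definition is_source :: "'v set \<Rightarrow> 'a set \<Rightarrow> ('a \<Rightarrow> 'v) \<Rightarrow> 'v \<Rightarrow> bool" where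
  "is_source V G r v \<longleftrightarrow> v \<in> V \<and> r -` {v} \<inter> G = {}"

definition graphed_semigroupoid ::
    "'v set \<Rightarrow> 'a set \<Rightarrow> ('a \<Rightarrow> 'v) \<Rightarrow> ('a \<Rightarrow> 'v) \<Rightarrow> ('a \<times> 'a \<Rightarrow> 'a) \<Rightarrow> bool" where
  "graphed_semigroupoid V S s r \<mu> \<longleftrightarrow>
     graph V S s r \<and>
     V = s ` S \<union> r ` S \<and>
     \<mu> \<in> composable_pairs S s r \<rightarrow> S \<and>
     (\<forall>(a, b) \<in> composable_pairs S s r. s (\<mu> (a, b)) = s b \<and> r (\<mu> (a, b)) = r a) \<and>
     (\<forall>(a, b, c) \<in> composable_triples S s r. \<mu> (\<mu> (a, b), c) = \<mu> (a, \<mu> (b, c)))"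

definition exel_semigroupoid ::
    "'a set \<Rightarrow> ('a \<times> 'a) set \<Rightarrow> ('a \<times> 'a \<Rightarrow> 'a) \<Rightarrow> bool" where
  "exel_semigroupoid L L2 \<mu> \<longleftrightarrow>
     L2 \<subseteq> L \<times> L \<and>
     \<mu> \<in> L2 \<rightarrow> L \<and>
     (\<forall>f\<in>L. \<forall>g\<in>L. \<forall>h\<in>L.
        ((f, g) \<in> L2 \<and> (g, h) \<in> L2 \<longleftrightarrow> (f, g) \<in> L2 \<and> (\<mu> (f, g), h) \<in> L2) \<and>
        ((f, g) \<in> L2 \<and> (\<mu> (f, g), h) \<in> L2 \<longleftrightarrow> (g, h) \<in> L2 \<and> (f, \<mu> (g, h)) \<in> L2) \<and>
        ((f, g) \<in> L2 \<and> (g, h) \<in> L2 \<longrightarrow> \<mu> (\<mu> (f, g), h) = \<mu> (f, \<mu> (g, h))))"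

end

theory Submission
  imports Defs
begin

text \<open>If the product \<open>ab\<close> inherits its source from \<open>b\<close> and its range from \<open>a\<close>, then each of the
  three composability conditions of an Exel semigroupoid on \<open>f, g, h\<close> unfolds to the same pair of
  equations \<open>s f = r g\<close> and \<open>s g = r h\<close>. So the equivalence of the three conditions
  is automatic, and what remains of the Exel axioms is associativity on composable triples
  (lemmas \<open>exel_of_graphed\<close> and \<open>graphed_of_exel\<close>).

  Conversely, an Exel semigroupoid sees the source of an arrow only through the arrows that
  can be composed with it on the right, and its range only through those on the left. By the Exel
  conditions, whatever composes with \<open>b\<close> on the right also composes with \<open>ab\<close> on the right;
  if some arrow \<open>c\<close> does so, then \<open>s (ab) = r c = s b\<close>. Such a \<open>c\<close> exists when \<open>s b\<close>
  is not a source. Dually, whatever composes with \<open>a\<close> on the left also composes with \<open>ab\<close> on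
  the left, which determines \<open>r (ab)\<close> as soon as \<open>r a\<close> is not a sink
  (lemma \<open>exel_endpoints\<close>).\<close>

lemma exel_of_graphed:
  assumes "graphed_semigroupoid V S s r \<mu>"
  shows "exel_semigroupoid S (composable_pairs S s r) \<mu>"
  using assms
  unfolding exel_semigroupoid_def graphed_semigroupoid_def composable_pairs_def
    composable_triples_def
  by (auto simp: Pi_iff)

lemma graphed_of_exel:
  assumes "graph V S s r" and "V = s ` S \<union> r ` S"
    and exel: "exel_semigroupoid S (composable_pairs S s r) \<mu>"
    and "\<forall>(a, b) \<in> composable_pairs S s r. s (\<mu> (a, b)) = s b \<and> r (\<mu> (a, b)) = r a"
  shows "graphed_semigroupoid V S s r \<mu>"
proof -
  have "\<mu> (\<mu> (a, b), c) = \<mu> (a, \<mu> (b, c))" if "(a, b, c) \<in> composable_triples S s r" for a b c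
    using exel that
    unfolding exel_semigroupoid_def composable_pairs_def composable_triples_def by auto
  then show ?thesis
    using assms unfolding graphed_semigroupoid_def exel_semigroupoid_def by auto
qed

text \<open>The two hypotheses on vertices provide test arrows: \<open>c\<close> behind \<open>b\<close> detects the
  source of \<open>ab\<close>, and \<open>d\<close> in front of \<open>a\<close> detects its range.\<close>

lemma exel_endpoints:
  assumes graph: "graph V S s r"
    and exel: "exel_semigroupoid S (composable_pairs S s r) \<mu>"
    and no_source: "\<nexists>v. is_source V S r v"
    and no_sink: "\<nexists>v. is_sink V S s v"
    and ab: "(a, b) \<in> composable_pairs S s r"
  shows "s (\<mu> (a, b)) = s b" and "r (\<mu> (a, b)) = r a"
proof -
  have a: "a \<in> S" and b: "b \<in> S"
    using ab by (auto simp: composable_pairs_def)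
  then have "s b \<in> V" and "r a \<in> V"
    using graph by (auto simp: graph_def)
  then obtain c d where c: "c \<in> S" "r c = s b" and d: "d \<in> S" "s d = r a"
    using no_source no_sink unfolding is_source_def is_sink_def by blast
  have "(b, c) \<in> composable_pairs S s r" and "(d, a) \<in> composable_pairs S s r"
    using a b c d by (auto simp: composable_pairs_def)
  then have "(\<mu> (a, b), c) \<in> composable_pairs S s r"
    and "(d, \<mu> (a, b)) \<in> composable_pairs S s r"
    using exel ab a b c(1) d(1) unfolding exel_semigroupoid_def by blast+
  then show "s (\<mu> (a, b)) = s b" and "r (\<mu> (a, b)) = r a"
    using c d by (auto simp: composable_pairs_def)
qed

theorem proposition2p11:
  fixes V :: "'v set" and S :: "'a set"
    and s r :: "'a \<Rightarrow> 'v" and \<mu> :: "'a \<times> 'a \<Rightarrow> 'a"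
  assumes "graph V S s r"
    and "V = s ` S \<union> r ` S"
    and "\<mu> \<in> composable_pairs S s r \<rightarrow> S"
  shows "(graphed_semigroupoid V S s r \<mu> \<longleftrightarrow>
            exel_semigroupoid S (composable_pairs S s r) \<mu> \<and>
            (\<forall>(a, b) \<in> composable_pairs S s r. s (\<mu> (a, b)) = s b \<and> r (\<mu> (a, b)) = r a)) \<and>
         ((\<nexists>v. is_source V S r v) \<and> (\<nexists>v. is_sink V S s v) \<longrightarrow>
            (exel_semigroupoid S (composable_pairs S s r) \<mu> \<longrightarrow>
              (\<forall>(a, b) \<in> composable_pairs S s r. s (\<mu> (a, b)) = s b \<and> r (\<mu> (a, b)) = r a)) \<and>
            (graphed_semigroupoid V S s r \<mu> \<longleftrightarrow>
              exel_semigroupoid S (composable_pairs S s r) \<mu>))"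
proof -
  let ?exel = "exel_semigroupoid S (composable_pairs S s r) \<mu>"
  let ?ends = "\<forall>(a, b) \<in> composable_pairs S s r. s (\<mu> (a, b)) = s b \<and> r (\<mu> (a, b)) = r a"
  have iff: "graphed_semigroupoid V S s r \<mu> \<longleftrightarrow> ?exel \<and> ?ends"
  proof
    assume graphed: "graphed_semigroupoid V S s r \<mu>"
    then have ?ends
      by (simp add: graphed_semigroupoid_def)
    with exel_of_graphed[OF graphed] show "?exel \<and> ?ends" ..
  next
    assume "?exel \<and> ?ends"
    then show "graphed_semigroupoid V S s r \<mu>"
      using graphed_of_exel[OF assms(1,2)] by blast
  qed
  have ends: ?ends if "\<nexists>v. is_source V S r v" "\<nexists>v. is_sink V S s v" ?exel
    using exel_endpoints[OF assms(1) that(3,1,2)] by blast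
  show ?thesis
    using iff ends by blast
qed

end
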